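(* Let $G=(V,E)$ be a finite connected graph with at least two vertices, and let $F=\bigcup_{i=0}^{\infty}F_i\subseteq V\times V$, where the sets $F_i$ are defined recursively in the context. If $F\neq V\times V$, then there exists a uniform avoidance coupling of two simple random walks on $G$.
   Context: Here $x\sim y$ means adjacent, $N(x)$ is the set of neighbors of $x$, and $d(x)=|N(x)|$. A simple random walk on $G$ moves from $v$ to each neighbor with probability $1/d(v)$. A Markovian avoidance process of two tokens $X,Y$ on $V$ is a (time-homogeneous) Markov chain on $V\times V$ with transition probabilities $T[(x,y)\rightarrow(x',y')]$ and stationary distribution $s$, such that $s(v,v)=0$ for all $v\in V$, and whenever $s(v,w)>0$ one has $T[(v,w)\rightarrow(w,u)]=0$ for all $u\in V$. A uniform avoidance coupling of two simple random walks on $G$ is a Markovian avoidance process such that for every state $(x,y)$ with $s(x,y)>0$: $\sum_{y'}T[(x,y)\rightarrow(x',y')]$ equals $1/d(x)$ if $x'\sim x$ and $0$ otherwise, and $\sum_{x'}T[(x,y)\rightarrow(x',y')]$ equals $1/d(y)$ if $y'\sim y$ and $0$ otherwise. Recursive definition: $F_0=\{(x,y)\in V\times V: x\sim y\}$. Given $F_i$, the set $F_{i+1}$ consists of all elements of $F_i$ together with all $(x,y)\notin F_i$ that fail the following test. Form the bipartite graph with left side $N(x)$ and right side $N(y)$ (a common neighbor of $x$ and $y$ has one copy on each side), with an arc from $x'\in N(x)$ to $y'\in N(y)$ if and only if $x'\ne y'$ and $(x',y')\notin F_i$. The pair $(x,y)$ passes the test if and only if there is a nonnegative flow on the arcs such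 that each left node sends out total $1/d(x)$ and each right node receives total $1/d(y)$. (When $d(y)\ge d(x)$ this is equivalent to: every $A\subseteq N(x)$ has at least $|A|\,d(y)/d(x)$ out-neighbors on the right side.) *)

theory Defs
  imports "Graph_Theory.Graph_Theory" "HOL-Probability.Probability_Mass_Function"
begin

definition nbrs :: "'a pair_pre_digraph \<Rightarrow> 'a \<Rightarrow> 'a set" where
  "nbrs G x = {y. (x, y) \<in> parcs G}"

definition deg :: "'a pair_pre_digraph \<Rightarrow> 'a \<Rightarrow> nat" where
  "deg G x = card (nbrs G x)"

definition srw_prob :: "'a pair_pre_digraph \<Rightarrow> 'a \<Rightarrow> 'a \<Rightarrow> real" where
  "srw_prob G x x' = (if x' \<in> nbrs G x then 1 / real (deg G x) else 0)"

definition stationary_markov_chain ::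
    "'s set \<Rightarrow> ('s \<Rightarrow> 's pmf) \<Rightarrow> 's pmf \<Rightarrow> bool" where
  "stationary_markov_chain S T s \<longleftrightarrow>
     (\<forall>p\<in>S. set_pmf (T p) \<subseteq> S) \<and> set_pmf s \<subseteq> S \<and> bind_pmf s T = s"

text \<open>
  The tokens move alternately, \<open>X\<close> first: the condition on \<open>T\<close> says that \<open>X\<close> never steps onto
  the current position of \<open>Y\<close>, the condition on \<open>s\<close> that \<open>Y\<close> never steps onto the new position
  of \<open>X\<close>.
\<close>

definition avoidance_process ::
    "'a set \<Rightarrow> ('a \<times> 'a \<Rightarrow> ('a \<times> 'a) pmf) \<Rightarrow> ('a \<times> 'a) pmf \<Rightarrow> bool" where
  "avoidance_process V T s \<longleftrightarrow>
     stationary_markov_chain (V \<times> V) T s \<and>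
     (\<forall>v\<in>V. pmf s (v, v) = 0) \<and>
     (\<forall>v\<in>V. \<forall>w\<in>V. pmf s (v, w) > 0 \<longrightarrow> (\<forall>u\<in>V. pmf (T (v, w)) (w, u) = 0))"

definition uniform_avoidance_coupling ::
    "'a pair_pre_digraph \<Rightarrow> ('a \<times> 'a \<Rightarrow> ('a \<times> 'a) pmf) \<Rightarrow> ('a \<times> 'a) pmf \<Rightarrow> bool" where
  "uniform_avoidance_coupling G T s \<longleftrightarrow>
     avoidance_process (pverts G) T s \<and>
     (\<forall>x\<in>pverts G. \<forall>y\<in>pverts G. pmf s (x, y) > 0 \<longrightarrow>
        (\<forall>x'\<in>pverts G. (\<Sum>y'\<in>pverts G. pmf (T (x, y)) (x', y')) = srw_prob G x x') \<and>
        (\<forall>y'\<in>pverts G. (\<Sum>x'\<in>pverts G. pmf (T (x, y)) (x', y')) = srw_prob G y y'))"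

text \<open>
  The arcs of the bipartite test graph: the first component of a pair is always a left node and
  the second one a right node, so that a common neighbor of \<open>x\<close> and \<open>y\<close> has one copy on each side.
\<close>

definition test_arcs ::
    "'a pair_pre_digraph \<Rightarrow> ('a \<times> 'a) set \<Rightarrow> 'a \<Rightarrow> 'a \<Rightarrow> ('a \<times> 'a) set" where
  "test_arcs G F x y =
     {(x', y'). x' \<in> nbrs G x \<and> y' \<in> nbrs G y \<and> x' \<noteq> y' \<and> (x', y') \<notin> F}"

definition passes_test ::
    "'a pair_pre_digraph \<Rightarrow> ('a \<times> 'a) set \<Rightarrow> 'a \<Rightarrow> 'a \<Rightarrow> bool" where
  "passes_test G F x y \<longleftrightarrow>
     (\<exists>f :: 'a \<times> 'a \<Rightarrow> real.
        (\<forall>e\<in>test_arcs G F x y. f e \<ge> 0) \<and>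
        (\<forall>x'\<in>nbrs G x. (\<Sum>y' | (x', y') \<in> test_arcs G F x y. f (x', y')) = 1 / real (deg G x)) \<and>
        (\<forall>y'\<in>nbrs G y. (\<Sum>x' | (x', y') \<in> test_arcs G F x y. f (x', y')) = 1 / real (deg G y)))"

primrec forbidden :: "'a pair_pre_digraph \<Rightarrow> nat \<Rightarrow> ('a \<times> 'a) set" where
  "forbidden G 0 = {(x, y). x \<in> pverts G \<and> y \<in> pverts G \<and> (x, y) \<in> parcs G}"
| "forbidden G (Suc i) = forbidden G i \<union>
     {(x, y). x \<in> pverts G \<and> y \<in> pverts G \<and> (x, y) \<notin> forbidden G i \<and>
              \<not> passes_test G (forbidden G i) x y}"

end

theory Submission
  imports Defs
begin

text \<open>
  The sets \<open>forbidden G i\<close> increase inside a finite set, so their union \<open>F\<close> satisfies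
  \<open>F = forbidden G n\<close> for some \<open>n\<close>, and every pair outside \<open>F\<close> passes the test relative to \<open>F\<close>.
  The flow witnessing the test is a transition law that has the two random walk marginals and is
  concentrated on off-diagonal pairs outside \<open>F\<close>.
  Hence the flows define a Markov chain on the complement of \<open>F\<close>, which is finite and nonempty and
  so carries a stationary distribution; stationarity forces this distribution off the diagonal, and
  \<open>X\<close> never steps onto \<open>Y\<close> since adjacent pairs lie in \<open>F\<close>.
\<close>

section \<open>Stationary distributions of finite Markov chains\<close>

text \<open>
  State elimination: a stationary measure of the chain watched only while outside \<open>a\<close> extends to
  \<open>a\<close> by solving the balance equation at \<open>a\<close>.
\<close>

lemma stochastic_stationary_measure:
  fixes P :: "'s \<Rightarrow> 's \<Rightarrow> real"
  assumes "finite S" "S \<noteq> {}"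
    and "\<And>i j. i \<in> S \<Longrightarrow> j \<in> S \<Longrightarrow> P i j \<ge> 0"
    and "\<And>i. i \<in> S \<Longrightarrow> (\<Sum>j\<in>S. P i j) = 1"
  shows "\<exists>m. (\<forall>i\<in>S. m i \<ge> 0) \<and> (\<Sum>i\<in>S. m i) > 0 \<and> (\<forall>j\<in>S. (\<Sum>i\<in>S. m i * P i j) = m j)"
  using assms
proof (induction S arbitrary: P rule: finite_ne_induct)
  case (singleton a)
  then show ?case by (intro exI[of _ "\<lambda>_. 1"]) auto
next
  case (insert a S)
  have nonneg: "P i j \<ge> 0" if "i \<in> insert a S" "j \<in> insert a S" for i j
    using insert.prems(1) that by blast
  have row: "P i a + (\<Sum>j\<in>S. P i j) = 1" if "i \<in> insert a S" for i
    using insert.prems(2)[OF that] insert.hyps by simp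
  show ?case
  proof (cases "P a a = 1")
    \<comment> \<open>Here \<open>a\<close> is absorbing, so the excursions through \<open>a\<close>
      used below have no return; the point mass at \<open>a\<close> is itself stationary.\<close>
    case True
    then have "(\<Sum>j\<in>S. P a j) = 0" using row[of a] by simp
    then have "P a j = 0" if "j \<in> S" for j
      using that nonneg insert.hyps by (simp add: sum_nonneg_eq_0_iff)
    moreover have "(\<Sum>i\<in>S. (if i = a then 1 else 0) * P i j) = 0" for j
      using insert.hyps by (intro sum.neutral) auto
    moreover have "(\<Sum>i\<in>S. if i = a then 1 else 0) = (0::real)"
      using insert.hyps by (intro sum.neutral) auto
    ultimately show ?thesis
      using True insert.hyps by (intro exI[of _ "\<lambda>i. if i = a then 1 else 0"]) auto
  next
    case False
    define c where "c = 1 - P a a"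
    have c_sum: "(\<Sum>j\<in>S. P a j) = c" using row[of a] by (simp add: c_def)
    have "c \<ge> 0" unfolding c_sum[symmetric] by (intro sum_nonneg) (simp add: nonneg)
    then have c: "c > 0" using False by (simp add: c_def)
    \<comment> \<open>From \<open>i\<close> the next state outside \<open>a\<close> is reached
      directly, or by stepping to \<open>a\<close>, looping there, and leaving to \<open>j\<close>;
      the loops contribute the geometric series of \<open>P a a\<close>, with sum
      \<open>1 / c\<close>.\<close>
    define Q where "Q i j = P i j + P i a * P a j / c" for i j
    have "\<exists>m. (\<forall>i\<in>S. m i \<ge> 0) \<and> (\<Sum>i\<in>S. m i) > 0 \<and> (\<forall>j\<in>S. (\<Sum>i\<in>S. m i * Q i j) = m j)"
    proof (rule insert.IH)
      show "Q i j \<ge> 0" if "i \<in> S" "j \<in> S" for i j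
        using that c nonneg by (simp add: Q_def)
      show "(\<Sum>j\<in>S. Q i j) = 1" if "i \<in> S" for i
      proof -
        have "(\<Sum>j\<in>S. Q i j) = (\<Sum>j\<in>S. P i j) + P i a * (\<Sum>j\<in>S. P a j) / c"
          by (simp add: Q_def sum.distrib sum_distrib_left sum_divide_distrib)
        then show ?thesis using row[of i] that c c_sum by simp
      qed
    qed
    then obtain m where m: "\<And>i. i \<in> S \<Longrightarrow> m i \<ge> 0" "(\<Sum>i\<in>S. m i) > 0"
      "\<And>j. j \<in> S \<Longrightarrow> (\<Sum>i\<in>S. m i * Q i j) = m j" by blast
    define b where "b = (\<Sum>i\<in>S. m i * P i a) / c"
    have b: "b \<ge> 0"
      using c m(1) nonneg by (auto simp: b_def intro!: divide_nonneg_pos sum_nonneg)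
    have at_a: "b * P a a + (\<Sum>i\<in>S. m i * P i a) = b"
    proof -
      have "(\<Sum>i\<in>S. m i * P i a) = b * c" using c by (simp add: b_def)
      then show ?thesis by (simp add: c_def algebra_simps)
    qed
    \<comment> \<open>The mass \<open>b * P a j\<close> flowing from \<open>a\<close> to
      \<open>j\<close> is exactly the excursion term of \<open>Q\<close>, so balance at
      \<open>j\<close> is stationarity of \<open>m\<close> under \<open>Q\<close>.\<close>
    have off_a: "b * P a j + (\<Sum>i\<in>S. m i * P i j) = m j" if "j \<in> S" for j
    proof -
      have "(\<Sum>i\<in>S. m i * Q i j) = (\<Sum>i\<in>S. m i * P i j) + (\<Sum>i\<in>S. m i * P i a * (P a j / c))"
        by (simp add: Q_def sum.distrib[symmetric] algebra_simps)
      also have "(\<Sum>i\<in>S. m i * P i a * (P a j / c)) = b * P a j"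
        unfolding b_def sum_distrib_right[symmetric] by simp
      finally show ?thesis using m(3)[OF that] by simp
    qed
    define m' where "m' = m(a := b)"
    have m'_a: "m' a = b" and m'_S: "i \<in> S \<Longrightarrow> m' i = m i" for i
      using insert.hyps by (auto simp: m'_def)
    have "(\<Sum>i\<in>S. m' i) = (\<Sum>i\<in>S. m i)" and "(\<Sum>i\<in>S. m' i * P i j) = (\<Sum>i\<in>S. m i * P i j)" for j
      by (auto intro!: sum.cong simp: m'_S)
    then show ?thesis
      using insert.hyps m(1,2) b at_a off_a by (intro exI[of _ m']) (auto simp: m'_a m'_S)
  qed
qed

lemma pmf_of_finite_weights:
  fixes f :: "'s \<Rightarrow> real"
  assumes "finite S" "\<And>x. x \<in> S \<Longrightarrow> f x \<ge> 0" "(\<Sum>x\<in>S. f x) = 1"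
  obtains p where "\<And>x. pmf p x = (if x \<in> S then f x else 0)"
proof -
  let ?g = "\<lambda>x. if x \<in> S then f x else 0"
  have "(\<integral>\<^sup>+ x. ennreal (?g x) \<partial>count_space UNIV) = (\<Sum>x\<in>S. ennreal (?g x))"
    using assms(1) by (intro nn_integral_count_space') auto
  also have "\<dots> = ennreal (\<Sum>x\<in>S. f x)"
    using assms(2) by (subst sum_ennreal[symmetric]) auto
  finally have "pmf (embed_pmf ?g) x = ?g x" for x
    using assms by (intro pmf_embed_pmf) auto
  then show ?thesis using that by blast
qed

text \<open>Closedness makes the restriction of \<open>T\<close> to \<open>S\<close> a stochastic
  matrix, and its stationary measure has positive total mass, so it can be normalised.\<close>

lemma finite_stationary_pmf:
  fixes T :: "'s \<Rightarrow> 's pmf"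
  assumes S: "finite S" "S \<noteq> {}" and closed: "\<And>i. i \<in> S \<Longrightarrow> set_pmf (T i) \<subseteq> S"
  obtains s where "set_pmf s \<subseteq> S" "bind_pmf s T = s"
proof -
  have "(\<Sum>j\<in>S. pmf (T i) j) = 1" if "i \<in> S" for i
    using S closed[OF that] by (simp add: sum_pmf_eq_1)
  then obtain m where m: "\<And>i. i \<in> S \<Longrightarrow> m i \<ge> 0" "(\<Sum>i\<in>S. m i) > 0"
    "\<And>j. j \<in> S \<Longrightarrow> (\<Sum>i\<in>S. m i * pmf (T i) j) = m j"
    using stochastic_stationary_measure[OF S, of "\<lambda>i j. pmf (T i) j"] by auto
  define c where "c = (\<Sum>i\<in>S. m i)"
  obtain s where s: "\<And>x. pmf s x = (if x \<in> S then m x / c else 0)"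
  proof (rule pmf_of_finite_weights[OF S(1), of "\<lambda>x. m x / c"])
    show "m x / c \<ge> 0" if "x \<in> S" for x using m that by (simp add: c_def)
    show "(\<Sum>x\<in>S. m x / c) = 1" using m by (simp add: c_def sum_divide_distrib[symmetric])
  qed blast
  have sub: "set_pmf s \<subseteq> S" by (auto simp: set_pmf_eq s)
  have "bind_pmf s T = s"
  proof (rule pmf_eqI)
    fix j
    have "pmf (bind_pmf s T) j = (\<Sum>i\<in>S. pmf s i * pmf (T i) j)"
      using S sub by (simp add: pmf_bind integral_measure_pmf_real[of S] subset_iff mult.commute)
    also have "\<dots> = (\<Sum>i\<in>S. m i * pmf (T i) j) / c"
      by (simp add: s sum_divide_distrib)
    also have "\<dots> = pmf s j"
    proof (cases "j \<in> S")
      \<comment> \<open>Outside \<open>S\<close> both sides vanish, since no step from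
        \<open>S\<close> reaches \<open>j\<close>.\<close>
      case False
      then have "pmf (T i) j = 0" if "i \<in> S" for i
        using closed[OF that] by (auto simp: set_pmf_eq)
      then show ?thesis using False by (simp add: s)
    qed (simp add: s m(3))
    finally show "pmf (bind_pmf s T) j = pmf s j" .
  qed
  then show ?thesis using that sub by blast
qed

section \<open>Neighbourhoods, and couplings obtained from flows\<close>

lemma pair_graph_nbrs_subset:
  assumes "pair_graph G"
  shows "nbrs G x \<subseteq> pverts G"
proof -
  interpret pair_graph G by fact
  show ?thesis by (auto simp: nbrs_def dest: in_arcsD2)
qed

text \<open>The arc set is symmetric, so connectedness gives a directed path from \<open>x\<close>
  to some other vertex; its first arc leads to a neighbor.\<close>

lemma connected_nbrs_nonempty:
  assumes "pair_graph G" "Digraph_Component.connected (with_proj G)"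
    and "card (pverts G) \<ge> 2" "x \<in> pverts G"
  shows "nbrs G x \<noteq> {}"
proof -
  interpret pair_graph G by fact
  have "\<not> pverts G \<subseteq> {x}" using assms(3) card_mono[of "{x}" "pverts G"] by auto
  then obtain y where y: "y \<in> pverts G" "y \<noteq> x" by blast
  have "strongly_connected (with_proj G)"
    using assms(2) symmetric_connected_imp_strongly_connected by blast
  then have "x \<rightarrow>\<^sup>*\<^bsub>with_proj G\<^esub> y"
    using assms(4) y by (auto simp: strongly_connected_def)
  then show ?thesis
    using y by (cases rule: converse_reachable_cases) (auto simp: nbrs_def)
qed

text \<open>The flow, extended by zero off the arcs, is the joint law of the two next positions; the
  node conditions of the test are its marginals.\<close>

lemma passes_test_obtains_coupling:
  assumes V: "finite V" "nbrs G x \<subseteq> V" "nbrs G y \<subseteq> V" and ne: "nbrs G x \<noteq> {}"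
    and test: "passes_test G F x y"
  obtains p where "set_pmf p \<subseteq> test_arcs G F x y"
    and "\<And>x'. (\<Sum>y'\<in>V. pmf p (x', y')) = srw_prob G x x'"
    and "\<And>y'. (\<Sum>x'\<in>V. pmf p (x', y')) = srw_prob G y y'"
proof -
  let ?A = "test_arcs G F x y"
  obtain f :: "'a \<times> 'a \<Rightarrow> real" where f: "\<And>e. e \<in> ?A \<Longrightarrow> f e \<ge> 0"
    and left: "\<And>x'. x' \<in> nbrs G x \<Longrightarrow> (\<Sum>y' | (x', y') \<in> ?A. f (x', y')) = 1 / real (deg G x)"
    and right: "\<And>y'. y' \<in> nbrs G y \<Longrightarrow> (\<Sum>x' | (x', y') \<in> ?A. f (x', y')) = 1 / real (deg G y)"
    using test unfolding passes_test_def by blast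
  have A_sub: "?A \<subseteq> nbrs G x \<times> nbrs G y" by (auto simp: test_arcs_def)
  have fin: "finite (nbrs G x)" "finite (nbrs G y)" using V finite_subset by blast+
  then have "finite ?A" using A_sub finite_subset by blast
  have fin_row: "finite {y'. (x', y') \<in> ?A}" for x'
    using A_sub by (intro finite_subset[OF _ fin(2)]) auto
  have "(\<Sum>e\<in>?A. f e) = (\<Sum>x'\<in>nbrs G x. \<Sum>y' | (x', y') \<in> ?A. f (x', y'))"
  proof -
    have "?A = Sigma (nbrs G x) (\<lambda>x'. {y'. (x', y') \<in> ?A})" using A_sub by auto
    then have "(\<Sum>e\<in>?A. f e) = (\<Sum>(x', y')\<in>Sigma (nbrs G x) (\<lambda>x'. {y'. (x', y') \<in> ?A}). f (x', y'))"
      by (auto intro: sum.cong)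
    then show ?thesis using fin fin_row by (simp add: sum.Sigma)
  qed
  \<comment> \<open>There are \<open>deg G x\<close> left nodes, each sending
    \<open>1 / deg G x\<close>; \<open>ne\<close> excludes degree zero, where the total would be
    0.\<close>
  also have "\<dots> = 1"
    using left fin ne by (simp add: deg_def)
  finally obtain p where p: "\<And>e. pmf p e = (if e \<in> ?A then f e else 0)"
    using pmf_of_finite_weights[OF \<open>finite ?A\<close>, of f] f by blast
  have "(\<Sum>y'\<in>V. pmf p (x', y')) = srw_prob G x x'" for x'
  proof -
    have "(\<Sum>y'\<in>V. pmf p (x', y')) = (\<Sum>y' | (x', y') \<in> ?A. f (x', y'))"
      using V A_sub by (intro sum.mono_neutral_cong_right) (auto simp: p)
    moreover have "{y'. (x', y') \<in> ?A} = {}" if "x' \<notin> nbrs G x" using that A_sub by auto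
    ultimately show ?thesis using left by (auto simp: srw_prob_def simp del: Collect_empty_eq)
  qed
  moreover have "(\<Sum>x'\<in>V. pmf p (x', y')) = srw_prob G y y'" for y'
  proof -
    have "(\<Sum>x'\<in>V. pmf p (x', y')) = (\<Sum>x' | (x', y') \<in> ?A. f (x', y'))"
      using V A_sub by (intro sum.mono_neutral_cong_right) (auto simp: p)
    moreover have "{x'. (x', y') \<in> ?A} = {}" if "y' \<notin> nbrs G y" using that A_sub by auto
    ultimately show ?thesis using right by (auto simp: srw_prob_def simp del: Collect_empty_eq)
  qed
  moreover have "set_pmf p \<subseteq> ?A" by (auto simp: set_pmf_eq p split: if_splits)
  ultimately show ?thesis using that by blast
qed

section \<open>The limit of the sets \<open>forbidden G i\<close>\<close>

lemma forbidden_subset: "forbidden G i \<subseteq> pverts G \<times> pverts G"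
  by (induction i) auto

lemma forbidden_mono: "i \<le> j \<Longrightarrow> forbidden G i \<subseteq> forbidden G j"
  by (rule lift_Suc_mono_le) auto

lemma forbidden_stabilizes:
  assumes "finite (pverts G)"
  obtains n where "(\<Union>i. forbidden G i) = forbidden G n"
proof -
  let ?F = "\<Union>i. forbidden G i"
  have "finite ?F"
    using assms forbidden_subset by (intro finite_subset[of ?F "pverts G \<times> pverts G"]) blast+
  obtain k where k: "\<And>e. e \<in> ?F \<Longrightarrow> e \<in> forbidden G (k e)" by (metis UN_E)
  \<comment> \<open>The latest of the finitely many entry stages contains everything. If
    \<open>?F\<close> is empty, \<open>Max\<close> is unspecified but the inclusion is
    trivial.\<close>
  have "?F \<subseteq> forbidden G (Max (k ` ?F))"
  proof
    fix e assume e: "e \<in> ?F"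
    then have "k e \<le> Max (k ` ?F)" using \<open>finite ?F\<close> by (intro Max_ge) blast+
    then show "e \<in> forbidden G (Max (k ` ?F))" using k[OF e] forbidden_mono by blast
  qed
  then show ?thesis using that[of "Max (k ` ?F)"] by blast
qed

text \<open>At a stage \<open>n\<close> that already equals the union, a pair absent from stage
  \<open>Suc n\<close> must have passed the test relative to the union itself.\<close>

lemma not_forbidden_passes_test:
  assumes "finite (pverts G)" "x \<in> pverts G" "y \<in> pverts G" "(x, y) \<notin> (\<Union>i. forbidden G i)"
  shows "passes_test G (\<Union>i. forbidden G i) x y"
proof -
  obtain n where n: "(\<Union>i. forbidden G i) = forbidden G n"
    using forbidden_stabilizes[OF assms(1)] .
  have "(x, y) \<notin> forbidden G n" "(x, y) \<notin> forbidden G (Suc n)" using assms(4) by blast+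
  then show ?thesis unfolding n using assms(2,3) by simp
qed

section \<open>The avoidance chain on the complement of the forbidden pairs\<close>

theorem theorem7p6:
  fixes G :: "'a pair_pre_digraph"
  assumes "pair_graph G"
    and "Digraph_Component.connected (with_proj G)"
    and "card (pverts G) \<ge> 2"
    and "(\<Union>i. forbidden G i) \<noteq> pverts G \<times> pverts G"
  shows "\<exists>T s. uniform_avoidance_coupling G T s"
proof -
  define V where "V = pverts G"
  define F where "F = (\<Union>i. forbidden G i)"
  define A where "A = V \<times> V - F"
  have V: "finite V"
    using assms(3) by (intro card_ge_0_finite) (simp add: V_def)
  have nbrs_V: "nbrs G x \<subseteq> V" for x
    using pair_graph_nbrs_subset[OF assms(1)] by (simp add: V_def)
  have "finite A" using V by (simp add: A_def)
  have "F \<subseteq> V \<times> V" using forbidden_subset by (auto simp: F_def V_def)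
  then have "A \<noteq> {}" using assms(4) by (auto simp: A_def F_def V_def)
  have "\<exists>p. set_pmf p \<subseteq> test_arcs G F (fst e) (snd e) \<and>
      (\<forall>x'. (\<Sum>y'\<in>V. pmf p (x', y')) = srw_prob G (fst e) x') \<and>
      (\<forall>y'. (\<Sum>x'\<in>V. pmf p (x', y')) = srw_prob G (snd e) y')" if "e \<in> A" for e
  proof -
    have e: "fst e \<in> V" "snd e \<in> V" "(fst e, snd e) \<notin> F" using that by (auto simp: A_def)
    have "passes_test G F (fst e) (snd e)"
      using not_forbidden_passes_test[of G] V e by (simp add: F_def V_def)
    moreover have "nbrs G (fst e) \<noteq> {}"
      using connected_nbrs_nonempty[OF assms(1-3)] e by (simp add: V_def)
    ultimately show ?thesis
      using passes_test_obtains_coupling[OF V nbrs_V nbrs_V] by metis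
  qed
  then obtain T0 where T0: "\<And>e. e \<in> A \<Longrightarrow> set_pmf (T0 e) \<subseteq> test_arcs G F (fst e) (snd e)"
    "\<And>e x'. e \<in> A \<Longrightarrow> (\<Sum>y'\<in>V. pmf (T0 e) (x', y')) = srw_prob G (fst e) x'"
    "\<And>e y'. e \<in> A \<Longrightarrow> (\<Sum>x'\<in>V. pmf (T0 e) (x', y')) = srw_prob G (snd e) y'"
    by metis
  \<comment> \<open>States outside \<open>A\<close> are frozen, only to keep \<open>T\<close> inside
    \<open>V \<times> V\<close> everywhere; \<open>s\<close> gives them no mass.\<close>
  define T where "T e = (if e \<in> A then T0 e else return_pmf e)" for e
  have T_A: "T e = T0 e" if "e \<in> A" for e using that by (simp add: T_def)
  have arcs_A: "test_arcs G F x y \<subseteq> A" for x y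
    using nbrs_V by (auto simp: test_arcs_def A_def)
  have T_closed: "set_pmf (T e) \<subseteq> A" if "e \<in> A" for e
    using T0(1)[OF that] arcs_A T_A[OF that] by auto
  obtain s where s: "set_pmf s \<subseteq> A" "bind_pmf s T = s"
    using finite_stationary_pmf[OF \<open>finite A\<close> \<open>A \<noteq> {}\<close> T_closed] .
  have pos: "e \<in> A" if "pmf s e > 0" for e
    using s(1) that by (auto simp: set_pmf_iff)
  have "stationary_markov_chain (V \<times> V) T s"
    using s T_closed by (auto simp: stationary_markov_chain_def T_def A_def split: if_splits)
  \<comment> \<open>\<open>A\<close> may contain diagonal pairs, but test arcs join distinct
    vertices, so one step from any state of \<open>A\<close> lands off the diagonal, and
    \<open>s\<close> is its own law after one step.\<close>
  moreover have "pmf s (v, v) = 0" for v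
  proof -
    have "(v, v) \<notin> set_pmf (T e)" if "e \<in> set_pmf s" for e
    proof -
      have "e \<in> A" using s(1) that by blast
      then show ?thesis using T0(1)[of e] T_A[of e] by (auto simp: test_arcs_def)
    qed
    then have "(v, v) \<notin> set_pmf (bind_pmf s T)" by auto
    then show ?thesis by (simp add: s(2) set_pmf_iff)
  qed
  moreover have "pmf (T (v, w)) (w, u) = 0" if "pmf s (v, w) > 0" for v w u
  proof -
    have vw: "(v, w) \<in> A" using pos that .
    \<comment> \<open>Stage 0 consists of the adjacent pairs, so \<open>w\<close> is not among the
      neighbors of \<open>v\<close> to which the first token can move.\<close>
    then have "(v, w) \<notin> forbidden G 0" unfolding A_def F_def by blast
    then have "w \<notin> nbrs G v" using vw by (simp add: nbrs_def A_def V_def)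
    then have "(w, u) \<notin> set_pmf (T (v, w))"
      using T0(1)[OF vw] T_A[OF vw] by (auto simp: test_arcs_def)
    then show ?thesis by (simp add: set_pmf_iff)
  qed
  ultimately have "avoidance_process V T s"
    by (simp add: avoidance_process_def)
  then have "uniform_avoidance_coupling G T s"
    using T0(2,3)[OF pos] T_A[OF pos]
    by (simp add: uniform_avoidance_coupling_def V_def)
  then show ?thesis by blast
qed

end
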